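(* Let $\lambda$ be a nonzero real number, let $Y$ be uniformly distributed on $[0,1]$, and let $k$ be a positive integer. Then \[ \frac{1}{k!}\big(\log_{\lambda}^{Y}(1+t)\big)^{k}=\sum_{n=k}^{\infty}S_{1,\lambda}^{Y}(n,k)\frac{t^{n}}{n!} =\sum_{n=k}^{\infty}\frac{2^{n}}{n}\binom{n}{k}\sum_{m=0}^{n-k}(n-m)\binom{n-k}{m}\sum_{j_1+\cdots+j_n=m}\binom{m}{j_1,\dots,j_n}A_{2,j_1}\cdots A_{2,j_n} \] \[ \times\sum_{l_1+\cdots+l_k=n-k-m}\binom{n-k-m}{l_1,\dots,l_k}\frac{\lambda^{n-k-m}}{(l_1+1)(l_2+1)\cdots(l_k+1)}\,\frac{t^{n}}{n!}, \] where the inner sums range over tuples of nonnegative integers.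
   Context: $e_{\lambda}(t)=(1+\lambda t)^{1/\lambda}$. For $Y\sim U[0,1]$, $E[e_{\lambda}^{Y}(t)]=E[(1+\lambda t)^{Y/\lambda}]=\frac{e_{\lambda}(t)-1}{\log e_{\lambda}(t)}$, a power series with constant term $1$ and linear coefficient $E[Y]=1/2$. The probabilistic degenerate logarithm $\log_{\lambda}^{Y}(1+t)$ is the compositional inverse of the delta series $E[e_{\lambda}^{Y}(t)]-1$, and $S_{1,\lambda}^{Y}(n,k)$ are defined by $\frac1{k!}\big(\log_{\lambda}^{Y}(1+t)\big)^k=\sum_{n\ge k}S_{1,\lambda}^{Y}(n,k)\frac{t^n}{n!}$. The numbers $A_{2,n}$ are defined by $\frac{\frac{1}{2}t^{2}}{e^{t}-1-t}=\sum_{n\ge0}A_{2,n}\frac{t^{n}}{n!}$. *)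

theory Defs
  imports "HOL-Probability.Probability" "HOL-Computational_Algebra.Computational_Algebra"
begin

text \<open>
  The formal power series \<open>(1 + \<lambda> t)\<^bsup>x/\<lambda>\<^esup>\<close>; the library's \<^const>\<open>fps_binomial\<close> \<open>c\<close> is \<open>(1 + t)\<^bsup>c\<^esup>\<close>.
\<close>

definition deg_exp :: "real \<Rightarrow> real \<Rightarrow> real fps" where
  "deg_exp lam x = fps_binomial (x / lam) oo (fps_const lam * fps_X)"

text \<open>The expectation of a random power series in \<open>t\<close> is taken coefficientwise.\<close>

definition expect_deg_exp :: "'a measure \<Rightarrow> ('a \<Rightarrow> real) \<Rightarrow> real \<Rightarrow> real fps" where
  "expect_deg_exp M Y lam = Abs_fps (\<lambda>n. \<integral>\<omega>. fps_nth (deg_exp lam (Y \<omega>)) n \<partial>M)"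

text \<open>
  \<open>prob_deg_log M Y lam\<close> is the series in \<open>t\<close> denoted \<open>log\<^sub>\<lambda>\<^sup>Y(1 + t)\<close>. The operator \<^const>\<open>fps_inv\<close> yields
  the compositional inverse of a delta series, so it is meaningful here when \<open>Y\<close> has moments of
  all orders and nonzero mean.
\<close>

definition prob_deg_log :: "'a measure \<Rightarrow> ('a \<Rightarrow> real) \<Rightarrow> real \<Rightarrow> real fps" where
  "prob_deg_log M Y lam = fps_inv (expect_deg_exp M Y lam - 1)"

definition prob_deg_stirling1 ::
    "'a measure \<Rightarrow> ('a \<Rightarrow> real) \<Rightarrow> real \<Rightarrow> nat \<Rightarrow> nat \<Rightarrow> real" where
  "prob_deg_stirling1 M Y lam n k =
     fact n * fps_nth (fps_const (1 / fact k) * prob_deg_log M Y lam ^ k) n"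

definition A2 :: "nat \<Rightarrow> real" where
  "A2 n = fact n * fps_nth ((fps_const (1 / 2) * fps_X ^ 2) / (fps_exp 1 - 1 - fps_X)) n"

definition multinomial :: "nat \<Rightarrow> nat list \<Rightarrow> real" where
  "multinomial m js = fact m / (\<Prod>j\<leftarrow>js. fact j)"

end

theory Submission
  imports Defs
begin

text \<open>
  Put \<open>G(u) = (e\<^bsup>\<lambda>u\<^esup> - 1) / \<lambda>\<close>, so that \<open>(1 + \<lambda> G(u))\<^bsup>y/\<lambda>\<^esup> = e\<^bsup>yu\<^esup>\<close>. Averaging over \<open>y\<close> uniform in \<open>[0,1]\<close> shows
  that the series \<open>E[e\<^sub>\<lambda>\<^sup>Y(t)] - 1\<close> composed with \<open>G\<close> is \<open>h(u) = (e\<^sup>u - 1 - u) / u\<close>; hence its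
  compositional inverse is \<open>G \<circ> h\<^sup>-\<^sup>1\<close>. Since \<open>u / h(u)\<close> is twice the generating function of the
  numbers \<open>A\<^sub>2\<^sub>,\<^sub>n\<close>, Lagrange inversion applied to \<open>G\<^sup>k / k!\<close> gives the coefficients.
\<close>

unbundle no vec_syntax

section \<open>Residues and Lagrange inversion\<close>

text \<open>
  The residue identity \<open>Res (h' / h\<^bsup>p+1\<^esup>) = \<delta>\<^sub>p\<^sub>0\<close>, written with \<open>\<phi> = t / h\<close> to stay within power series.
\<close>

lemma fps_power_deriv_nth_reciprocal:
  fixes h \<phi> :: "'a::field_char_0 fps"
  assumes "\<phi> * h = fps_X" and h0: "h $ 0 = 0"
  shows "(\<phi> ^ Suc p * fps_deriv h) $ p = (if p = 0 then 1 else 0)"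
proof -
  have d: "\<phi> * fps_deriv h = 1 - fps_deriv \<phi> * h"
    using arg_cong[OF assms(1), of fps_deriv] by (simp add: algebra_simps)
  show ?thesis
  proof (cases p)
    case 0
    have "\<phi> $ 0 * h $ 1 = 1"
      using arg_cong[OF assms(1), of "\<lambda>f. f $ 1"] h0 by (simp add: fps_mult_nth_1)
    with 0 show ?thesis by simp
  next
    case (Suc q)
    have "\<phi> ^ Suc p * fps_deriv h = \<phi> ^ p * (\<phi> * fps_deriv h)"
      by (simp add: mult_ac)
    also have "\<dots> = \<phi> ^ p - \<phi> ^ q * fps_deriv \<phi> * (\<phi> * h)"
      unfolding d by (simp add: Suc algebra_simps)
    also have "\<dots> = \<phi> ^ p - fps_X * (\<phi> ^ q * fps_deriv \<phi>)"
      unfolding assms(1) by (simp add: mult_ac)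
    finally have e: "(\<phi> ^ Suc p * fps_deriv h) $ p = \<phi> ^ p $ p - (\<phi> ^ q * fps_deriv \<phi>) $ q"
      by (simp add: Suc)
    \<comment> \<open>Comparing coefficients of degree \<open>q = p - 1\<close> in the derivative of
      \<open>\<phi> ^ p\<close> shows that the two terms of \<open>e\<close> cancel; dividing by
      \<open>p\<close> uses characteristic zero.\<close>
    have "fps_deriv (\<phi> ^ p) = of_nat p * (\<phi> ^ q * fps_deriv \<phi>)"
      unfolding fps_deriv_power' by (simp add: Suc mult_ac del: of_nat_Suc)
    then have "fps_deriv (\<phi> ^ p) $ q = of_nat p * (\<phi> ^ q * fps_deriv \<phi>) $ q"
      by (simp flip: fps_of_nat)
    then have "of_nat p * \<phi> ^ p $ p = of_nat p * (\<phi> ^ q * fps_deriv \<phi>) $ q"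
      unfolding fps_deriv_nth Suc by (simp only: Suc_eq_plus1)
    then have "\<phi> ^ p $ p = (\<phi> ^ q * fps_deriv \<phi>) $ q"
      using Suc by (metis mult_cancel_left of_nat_eq_0_iff nat.distinct(1))
    with e Suc show ?thesis by simp
  qed
qed

text \<open>With \<open>C = F oo fps_inv h\<close>, the chain rule for \<open>F = C oo h\<close>
  expands \<open>fps_deriv F\<close> as a combination of the series
  \<open>h ^ j * fps_deriv h\<close>. The residue identity makes only \<open>j = n\<close>
  contribute, which isolates one coefficient of \<open>fps_deriv C\<close>.\<close>

theorem fps_lagrange_inversion:
  fixes F h \<phi> :: "'a::field_char_0 fps"
  assumes "\<phi> * h = fps_X" and h0: "h $ 0 = 0"
  shows "of_nat (Suc n) * (F oo fps_inv h) $ Suc n = (fps_deriv F * \<phi> ^ Suc n) $ n"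
proof -
  define C where "C = F oo fps_inv h"
  have h1: "h $ 1 \<noteq> 0"
    using arg_cong[OF assms(1), of "\<lambda>f. f $ 1"] h0 by (auto simp: fps_mult_nth_1)
  have i0: "fps_inv h $ 0 = 0"
    by (simp add: fps_inv_def)
  have "C oo h = F oo (fps_inv h oo h)"
    unfolding C_def using fps_compose_assoc[OF h0 i0] by simp
  then have F: "F = C oo h"
    by (simp add: fps_inv[OF h0 h1])
  \<comment> \<open>Absorbing \<open>h ^ j\<close> into \<open>j\<close> of the factors
    \<open>\<phi>\<close> leaves a shift by \<open>fps_X ^ j\<close>, hence the residue identity
    with \<open>p = n - j\<close>.\<close>
  have main: "(h ^ j * (fps_deriv h * \<phi> ^ Suc n)) $ n = (if j = n then 1 else 0)" if "j \<le> n" for j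
  proof -
    have "h ^ j * (fps_deriv h * \<phi> ^ Suc n) = (\<phi> * h) ^ j * (\<phi> ^ Suc (n - j) * fps_deriv h)"
      using that by (simp add: power_mult_distrib Suc_diff_le mult_ac flip: power_add)
    then have "(h ^ j * (fps_deriv h * \<phi> ^ Suc n)) $ n = (\<phi> ^ Suc (n - j) * fps_deriv h) $ (n - j)"
      using that unfolding assms(1) by (simp only: fps_X_power_mult_nth) simp
    then show ?thesis
      unfolding fps_power_deriv_nth_reciprocal[OF assms] using that by auto
  qed
  \<comment> \<open>Since \<open>h ^ j\<close> starts in degree at least \<open>j\<close>, the terms
    with \<open>j > i\<close> vanish. A bound \<open>n\<close> independent of \<open>i\<close>
    allows the two sums to be swapped.\<close>
  have "(fps_deriv C oo h) $ i = (\<Sum>j=0..n. fps_deriv C $ j * h ^ j $ i)" if "i \<le> n" for i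
    unfolding fps_compose_nth using that h0
    by (intro sum.mono_neutral_left) (auto simp: startsby_zero_power_prefix)
  then have "(fps_deriv F * \<phi> ^ Suc n) $ n =
      (\<Sum>i=0..n. \<Sum>j=0..n. fps_deriv C $ j * (h ^ j $ i * (fps_deriv h * \<phi> ^ Suc n) $ (n - i)))"
    unfolding F fps_compose_deriv[OF h0] mult.assoc fps_mult_nth[of "fps_deriv C oo h"]
    by (intro sum.cong refl) (simp add: sum_distrib_right mult.assoc del: power_Suc)
  also have "\<dots> = (\<Sum>j=0..n. fps_deriv C $ j * (h ^ j * (fps_deriv h * \<phi> ^ Suc n)) $ n)"
    by (subst sum.swap) (simp add: fps_mult_nth[of "h ^ _"] sum_distrib_left del: power_Suc)
  also have "\<dots> = (\<Sum>j=0..n. if j = n then fps_deriv C $ j else 0)"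
    by (intro sum.cong refl) (simp add: main del: power_Suc)
  also have "\<dots> = of_nat (Suc n) * C $ Suc n"
    by simp
  finally show ?thesis unfolding C_def by simp
qed

section \<open>Compositional inverses and powers of series\<close>

lemma fps_inv_eqI:
  fixes f g :: "'a::field fps"
  assumes f0: "f $ 0 = 0" and g0: "g $ 0 = 0" and fg: "f oo g = fps_X"
  shows "fps_inv f = g"
proof -
  \<comment> \<open>A nonzero linear coefficient makes \<open>fps_inv f\<close> a genuine left
    inverse; associativity then identifies it with the right inverse \<open>g\<close>.\<close>
  have "f $ 1 * g $ 1 = 1"
    using arg_cong[OF fg, of "\<lambda>f. f $ 1"] by (simp add: fps_compose_nth)
  then have f1: "f $ 1 \<noteq> 0" by auto
  have "fps_inv f = fps_inv f oo (f oo g)" 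
    by (simp add: fg)
  also have "\<dots> = (fps_inv f oo f) oo g"
    by (rule fps_compose_assoc[OF g0 f0])
  also have "\<dots> = g"
    by (simp add: fps_inv[OF f0 f1] fps_X_fps_compose_startby0[OF g0])
  finally show ?thesis .
qed

lemma multinomial_power_nth:
  fixes f :: "real fps"
  shows "fact m * (f ^ n) $ m =
    (\<Sum>js\<in>natpermute m n. multinomial m js * (\<Prod>j\<leftarrow>js. fact j * f $ j))"
proof (cases n)
  case 0
  then show ?thesis by (simp add: natpermute_0 multinomial_def)
next
  case (Suc n')
  \<comment> \<open>The factorials weighting the coefficients in the product are exactly the
    denominator of \<open>multinomial m js\<close>.\<close>
  have "fact m * (\<Prod>j = 0..n'. f $ (js ! j)) =
      multinomial m js * (\<Prod>j\<leftarrow>js. fact j * f $ j)" if "js \<in> natpermute m n" for js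
  proof -
    have "length js = n" using that by (simp add: natpermute_def)
    then have "(\<Prod>j = 0..n'. f $ (js ! j)) = (\<Prod>j\<leftarrow>js. f $ j)"
      using Suc by (simp add: prod.list_conv_set_nth atLeast0LessThan atLeast0AtMost lessThan_Suc_atMost)
    moreover have "(\<Prod>j\<leftarrow>js. fact j * f $ j) = (\<Prod>j\<leftarrow>js. fact j) * (\<Prod>j\<leftarrow>js. f $ j)"
      by (induction js) simp_all
    moreover have "(\<Prod>j\<leftarrow>js. fact j :: real) \<noteq> 0"
      by (induction js) simp_all
    ultimately show ?thesis by (simp add: multinomial_def)
  qed
  then show ?thesis
    by (simp add: fps_power_nth sum_distrib_left Suc del: power_Suc)
qed

section \<open>The substitution that linearizes the degenerate exponential\<close>

text \<open>The binomial series satisfies \<open>(1 + t) B' = c B\<close>. Substituting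
  \<open>fps_exp d - 1\<close> turns this into a linear equation with constant coefficient
  \<open>c * d\<close>, whose solution with constant term 1 is the exponential.\<close>

lemma fps_binomial_compose_exp_minus_one:
  fixes c :: "'a::field_char_0"
  shows "fps_binomial c oo (fps_exp d - 1) = fps_exp (c * d)"
proof -
  let ?B = "fps_binomial c oo (fps_exp d - 1)"
  have z: "(fps_exp d - 1) $ 0 = 0" by simp
  have "(1 + fps_X) * fps_deriv (fps_binomial c) = fps_const c * fps_binomial c"
    by (simp add: fps_binomial_deriv fps_divide_unit mult_ac inverse_mult_eq_1')
  then have "((1 + fps_X) oo (fps_exp d - 1)) * (fps_deriv (fps_binomial c) oo (fps_exp d - 1))
      = (fps_const c oo (fps_exp d - 1)) * ?B"
    by (metis fps_compose_mult_distrib z)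
  then have *: "fps_exp d * (fps_deriv (fps_binomial c) oo (fps_exp d - 1)) = fps_const c * ?B"
    by (simp add: fps_compose_add_distrib fps_X_fps_compose_startby0)
  have "fps_deriv ?B = fps_const d * (fps_exp d * (fps_deriv (fps_binomial c) oo (fps_exp d - 1)))"
    unfolding fps_compose_deriv[OF z] by (simp add: mult_ac)
  also have "\<dots> = fps_const (c * d) * ?B"
    unfolding * by (simp add: fps_const_mult [symmetric] mult_ac del: fps_const_mult)
  finally have "?B = fps_const (?B $ 0) * fps_exp (c * d)"
    by (simp only: fps_exp_unique_ODE)
  then show ?thesis by simp
qed

text \<open>The compositional inverse of \<open>log(1 + \<lambda> t) / \<lambda> = log e\<^sub>\<lambda>(t)\<close>.\<close>

definition deg_exp_arg_inv :: "real \<Rightarrow> real fps" where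
  "deg_exp_arg_inv lam = fps_const (1 / lam) * (fps_exp lam - 1)"

lemma deg_exp_arg_inv_nth_0 [simp]: "deg_exp_arg_inv lam $ 0 = 0"
  by (simp add: deg_exp_arg_inv_def)

lemma deg_exp_compose_arg_inv:
  assumes "lam \<noteq> 0"
  shows "deg_exp lam x oo deg_exp_arg_inv lam = fps_exp x"
proof -
  have "deg_exp lam x oo deg_exp_arg_inv lam =
      fps_binomial (x / lam) oo ((fps_const lam * fps_X) oo deg_exp_arg_inv lam)"
    unfolding deg_exp_def by (rule fps_compose_assoc [symmetric]) simp_all
  also have "(fps_const lam * fps_X) oo deg_exp_arg_inv lam = fps_const lam * deg_exp_arg_inv lam"
    by (simp add: fps_compose_mult_distrib fps_X_fps_compose_startby0)
  also have "\<dots> = fps_exp lam - 1"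
    using assms by (simp add: deg_exp_arg_inv_def flip: mult.assoc)
  finally show ?thesis
    using assms by (simp add: fps_binomial_compose_exp_minus_one)
qed

lemma deg_exp_nth: "deg_exp lam x $ n = lam ^ n * ((x / lam) gchoose n)"
  by (simp add: deg_exp_def fps_compose_linear)

text \<open>Splitting off \<open>fps_X\<close> shows that the \<open>k\<close>-th power starts in
  degree \<open>k\<close> and leaves the series whose powers produce the sum over the
  \<open>l_i\<close>.\<close>

lemma deg_exp_arg_inv_eq:
  assumes "lam \<noteq> 0"
  shows "deg_exp_arg_inv lam = fps_X * Abs_fps (\<lambda>l. lam ^ l / fact (Suc l))"
proof (rule fps_ext)
  fix n show "deg_exp_arg_inv lam $ n = (fps_X * Abs_fps (\<lambda>l. lam ^ l / fact (Suc l))) $ n"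
    using assms by (cases n) (simp_all add: deg_exp_arg_inv_def algebra_simps)
qed

text \<open>The series \<open>(e\<^sup>t - 1) / t\<close>.\<close>

definition exp_quotient :: "real fps" where
  "exp_quotient = Abs_fps (\<lambda>n. 1 / fact (Suc n))"

section \<open>Expectation over the uniform distribution\<close>

lemma distributed_unit_interval:
  fixes g :: "real \<Rightarrow> real"
  assumes D: "distributed M lborel Y (\<lambda>x. indicator {0..1} x / measure lborel {0..1::real})"
    and g: "continuous_on UNIV g"
  shows "integrable M (\<lambda>\<omega>. g (Y \<omega>))"
    and "(\<integral>\<omega>. g (Y \<omega>) \<partial>M) = (\<integral>x. g x * indicator {0..1} x \<partial>lborel)"
proof -
  have m: "g \<in> borel_measurable lborel"
    using borel_measurable_continuous_onI[OF g] by simp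
  have D': "distributed M lborel Y (\<lambda>x. ennreal (indicator {0..1} x))"
    using D by simp
  have "integrable lborel (\<lambda>x. indicator {0..1} x * g x)"
    using borel_integrable_compact[of "{0..1::real}" g] continuous_on_subset[OF g] by simp
  with distributed_integrable[OF D' m] show "integrable M (\<lambda>\<omega>. g (Y \<omega>))"
    by simp
  show "(\<integral>\<omega>. g (Y \<omega>) \<partial>M) = (\<integral>x. g x * indicator {0..1} x \<partial>lborel)"
    using distributed_integral[OF D' m] by (simp add: mult.commute)
qed

text \<open>A coefficient of a composition is a finite sum, so expectation commutes with the
  substitution. What remains is the moment of \<open>Y ^ n\<close>, which is
  \<open>1 / (n + 1)\<close>.\<close>

lemma expect_deg_exp_compose_arg_inv:
  assumes D: "distributed M lborel Y (\<lambda>x. indicator {0..1} x / measure lborel {0..1::real})"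
    and lam: "lam \<noteq> 0"
  shows "expect_deg_exp M Y lam oo deg_exp_arg_inv lam = exp_quotient"
proof (rule fps_ext)
  fix n
  \<comment> \<open>Written as a product, the generalized binomial coefficient is a polynomial in
    \<open>Y \<omega>\<close>, hence continuous and integrable on the unit interval.\<close>
  have int: "integrable M (\<lambda>\<omega>. deg_exp lam (Y \<omega>) $ i)" for i
    unfolding deg_exp_nth gbinomial_prod_rev
    by (rule distributed_unit_interval(1)[OF D]) (use lam in \<open>auto intro!: continuous_intros\<close>)
  have "(expect_deg_exp M Y lam oo deg_exp_arg_inv lam) $ n =
      (\<Sum>i=0..n. (\<integral>\<omega>. deg_exp lam (Y \<omega>) $ i \<partial>M) * deg_exp_arg_inv lam ^ i $ n)"
    by (simp add: fps_compose_nth expect_deg_exp_def)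
  also have "\<dots> = (\<integral>\<omega>. (deg_exp lam (Y \<omega>) oo deg_exp_arg_inv lam) $ n \<partial>M)"
    by (simp add: fps_compose_nth int)
  also have "\<dots> = (\<integral>\<omega>. Y \<omega> ^ n / fact n \<partial>M)"
    by (simp add: deg_exp_compose_arg_inv[OF lam])
  also have "\<dots> = (\<integral>\<omega>. Y \<omega> ^ n \<partial>M) / fact n"
    by simp
  also have "(\<integral>\<omega>. Y \<omega> ^ n \<partial>M) = (\<integral>x. x ^ n * indicator {0..1} x \<partial>lborel)"
    by (rule distributed_unit_interval(2)[OF D]) (intro continuous_intros)
  also have "\<dots> = 1 / Suc n"
    by (simp add: integral_power)
  finally show "(expect_deg_exp M Y lam oo deg_exp_arg_inv lam) $ n = exp_quotient $ n"
    by (simp add: exp_quotient_def mult.commute)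
qed

lemma prob_deg_log_uniform:
  assumes D: "distributed M lborel Y (\<lambda>x. indicator {0..1} x / measure lborel {0..1::real})"
    and lam: "lam \<noteq> 0"
  shows "prob_deg_log M Y lam = deg_exp_arg_inv lam oo fps_inv (exp_quotient - 1)"
proof -
  let ?h = "exp_quotient - 1" and ?f = "expect_deg_exp M Y lam - 1"
  have h0: "?h $ 0 = 0" and h1: "?h $ 1 \<noteq> 0"
    by (simp_all add: exp_quotient_def)
  have i0: "fps_inv ?h $ 0 = 0"
    by (simp add: fps_inv_def)
  have fG: "?f oo deg_exp_arg_inv lam = ?h"
    by (simp add: fps_compose_sub_distrib expect_deg_exp_compose_arg_inv[OF D lam])
  then have f0: "?f $ 0 = 0"
    using h0 by (metis fps_compose_nth_0)
  have "?f oo (deg_exp_arg_inv lam oo fps_inv ?h) = fps_X"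
    by (simp add: fps_compose_assoc[OF i0] fG fps_inv_right[OF h0 h1])
  then show ?thesis
    unfolding prob_deg_log_def by (intro fps_inv_eqI f0) simp_all
qed

section \<open>The numbers \<open>A2\<close> and the coefficient formula\<close>

definition A2_fps :: "real fps" where
  "A2_fps = Abs_fps (\<lambda>n. A2 n / fact n)"

text \<open>This provides the \<open>\<phi>\<close> of Lagrange inversion for
  \<open>h = exp_quotient - 1\<close>; its factor 2 is the source of \<open>2 ^ n\<close> in the
  result.\<close>

lemma A2_fps_mult_exp_quotient: "fps_const 2 * A2_fps * (exp_quotient - 1) = fps_X"
proof -
  let ?D = "fps_exp 1 - 1 - fps_X :: real fps" and ?N = "fps_const (1/2) * fps_X ^ 2 :: real fps"
  have D: "?D = fps_X * (exp_quotient - 1)"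
  proof (rule fps_ext)
    fix n show "?D $ n = (fps_X * (exp_quotient - 1)) $ n"
      by (cases n) (auto simp: exp_quotient_def algebra_simps)
  qed
  \<comment> \<open>Both the denominator and \<open>fps_X ^ 2\<close> have subdegree 2, so the
    quotient defining \<open>A2\<close> is exact.\<close>
  have sub: "subdegree ?D = 2"
    by (rule subdegreeI) (auto simp: fps_X_def less_2_cases_iff)
  then have "?D \<noteq> 0" by auto
  have "?D dvd fps_X ^ 2"
    using sub \<open>?D \<noteq> 0\<close> by (subst fps_dvd_iff) auto
  then have "?D dvd ?N" by simp
  then have "?N / ?D * ?D = ?N" by (rule dvd_div_mult_self)
  moreover have "A2_fps = ?N / ?D"
    by (rule fps_ext) (simp add: A2_fps_def A2_def)
  ultimately have "fps_X * (fps_const 2 * A2_fps * (exp_quotient - 1)) = fps_X * fps_X"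
    unfolding D by (simp add: mult_ac power2_eq_square flip: mult.assoc)
  then show ?thesis by simp
qed

lemma fact_mult_A2_fps_power_nth:
  "fact m * (A2_fps ^ n) $ m = (\<Sum>js\<in>natpermute m n. multinomial m js * (\<Prod>j\<leftarrow>js. A2 j))"
  by (simp add: multinomial_power_nth A2_fps_def)

text \<open>Each factor contributes \<open>l! / (l + 1)! = 1 / (l + 1)\<close>, and the powers of
  \<open>lam\<close> collect to \<open>lam ^ r\<close> because the entries of \<open>ls\<close> sum
  to \<open>r\<close>.\<close>

lemma fact_mult_exp_quotient_scaled_power_nth:
  "fact r * (Abs_fps (\<lambda>l. lam ^ l / fact (Suc l)) ^ k) $ r =
    (\<Sum>ls\<in>natpermute r k. multinomial r ls * (lam ^ r / (\<Prod>l\<leftarrow>ls. real (l + 1))))"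
proof -
  have summand: "fact l * (lam ^ l / fact (Suc l)) = lam ^ l / real (l + 1)" for l
    by (simp add: divide_simps)
  have "(\<Prod>l\<leftarrow>ls. fact l * (lam ^ l / fact (Suc l))) = lam ^ sum_list ls / (\<Prod>l\<leftarrow>ls. real (l + 1))" for ls
    by (induction ls) (simp_all only: list.map prod_list.Nil prod_list.Cons sum_list.Nil sum_list.Cons summand power_add, simp_all)
  then show ?thesis
    unfolding multinomial_power_nth by (intro sum.cong refl) (simp add: natpermute_def)
qed

lemma prob_deg_log_power_nth:
  assumes D: "distributed M lborel Y (\<lambda>x. indicator {0..1} x / measure lborel {0..1::real})"
    and lam: "lam \<noteq> 0" and k: "k \<ge> 1"
  shows "(fps_const (1 / fact k) * prob_deg_log M Y lam ^ k) $ n =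
    (if n < k then 0 else
       2 ^ n / real n * real (n choose k) *
       (\<Sum>m = 0..n - k. real (n - m) * real ((n - k) choose m) *
          (\<Sum>js \<in> natpermute m n. multinomial m js * (\<Prod>j\<leftarrow>js. A2 j)) *
          (\<Sum>ls \<in> natpermute (n - k - m) k. multinomial (n - k - m) ls *
             (lam ^ (n - k - m) / (\<Prod>l\<leftarrow>ls. real (l + 1))))) / fact n)"
proof -
  define h where "h = exp_quotient - 1"
  define B where "B = Abs_fps (\<lambda>l. lam ^ l / fact (Suc l))"
  define F where "F = fps_const (1 / fact k) * deg_exp_arg_inv lam ^ k"
  have h0: "h $ 0 = 0" by (simp add: h_def exp_quotient_def)
  have i0: "fps_inv h $ 0 = 0" by (simp add: fps_inv_def)
  have L: "prob_deg_log M Y lam = deg_exp_arg_inv lam oo fps_inv h"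
    unfolding h_def by (rule prob_deg_log_uniform[OF D lam])
  have log: "fps_const (1 / fact k) * prob_deg_log M Y lam ^ k = F oo fps_inv h"
    by (simp add: F_def L fps_compose_mult_distrib[OF i0] fps_compose_power[OF i0])
  have F_nth: "F $ i = (if i < k then 0 else (B ^ k) $ (i - k) / fact k)" for i
    unfolding F_def deg_exp_arg_inv_eq[OF lam] B_def[symmetric] power_mult_distrib
    by (simp add: fps_X_power_mult_nth)
  show ?thesis
  proof (cases "n < k")
    case True
    have "prob_deg_log M Y lam $ 0 = 0" by (simp add: L)
    with True show ?thesis by (simp add: startsby_zero_power_prefix)
  next
    case False
    then obtain N where n: "n = Suc N" using k by (cases n) auto
    have "real n * (F oo fps_inv h) $ n = (fps_deriv F * (fps_const 2 * A2_fps) ^ n) $ N"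
      using fps_lagrange_inversion[OF A2_fps_mult_exp_quotient, of N F] h0 by (simp add: n h_def)
    \<comment> \<open>Cauchy product: as \<open>n = Suc N\<close>, the coefficient of
      \<open>fps_deriv F\<close> at \<open>N - m\<close> is
      \<open>(n - m) * F $ (n - m)\<close>.\<close>
    also have "\<dots> = (\<Sum>m=0..N. 2 ^ n * (A2_fps ^ n) $ m * (real (n - m) * F $ (n - m)))"
      unfolding mult.commute[of "fps_deriv F"] fps_mult_nth
      by (intro sum.cong refl)
        (simp add: n power_mult_distrib fps_const_power Suc_diff_le del: power_Suc)
    \<comment> \<open>For \<open>m > n - k\<close> the index \<open>n - m\<close> lies below
      \<open>k\<close>, where \<open>F\<close> vanishes; \<open>k \<ge> 1\<close> ensures
      \<open>n - k \<le> N\<close>.\<close>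
    also have "\<dots> = (\<Sum>m=0..n - k. 2 ^ n * (A2_fps ^ n) $ m * (real (n - m) * F $ (n - m)))"
      using False k by (intro sum.mono_neutral_right) (auto simp: n F_nth)
    \<comment> \<open>The factor \<open>1 / k!\<close> in \<open>F\<close> equals
      \<open>(n choose k) * (n - k)! / n!\<close>, and \<open>(n - k)!\<close> splits as
      \<open>((n - k) choose m) * m! * (n - k - m)!\<close>. The last two factorials normalize the
      two power coefficients.\<close>
    also have "\<dots> = (\<Sum>m=0..n - k. 2 ^ n * real (n choose k) / fact n *
        (real (n - m) * real ((n - k) choose m) * (fact m * (A2_fps ^ n) $ m) *
          (fact (n - k - m) * (B ^ k) $ (n - k - m))))"
    proof (intro sum.cong refl)
      fix m assume "m \<in> {0..n - k}"
      then have m: "m \<le> n - k" "\<not> n - m < k" "n - m - k = n - k - m" using False by auto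
      have "real (n choose k) = fact n / (fact k * fact (n - k))"
        using False by (simp add: binomial_fact)
      moreover have "real ((n - k) choose m) = fact (n - k) / (fact m * fact (n - k - m))"
        using m by (simp add: binomial_fact)
      ultimately show "2 ^ n * (A2_fps ^ n) $ m * (real (n - m) * F $ (n - m)) =
          2 ^ n * real (n choose k) / fact n *
          (real (n - m) * real ((n - k) choose m) * (fact m * (A2_fps ^ n) $ m) *
            (fact (n - k - m) * (B ^ k) $ (n - k - m)))"
        using m by (simp add: F_nth)
    qed
    also have "\<dots> = 2 ^ n * real (n choose k) / fact n *
        (\<Sum>m = 0..n - k. real (n - m) * real ((n - k) choose m) *
          (\<Sum>js \<in> natpermute m n. multinomial m js * (\<Prod>j\<leftarrow>js. A2 j)) *
          (\<Sum>ls \<in> natpermute (n - k - m) k. multinomial (n - k - m) ls *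
             (lam ^ (n - k - m) / (\<Prod>l\<leftarrow>ls. real (l + 1)))))"
      unfolding B_def fact_mult_A2_fps_power_nth fact_mult_exp_quotient_scaled_power_nth
      by (rule sum_distrib_left [symmetric])
    finally have coeff: "real n * (F oo fps_inv h) $ n = \<dots>" .
    have cancel: "x = a / real n * b * S / c" if "real n * x = a * b / c * S" for x a b c S :: real
    proof -
      have "x = real n * x / real n"
        by (simp add: n del: of_nat_Suc)
      also have "\<dots> = a / real n * b * S / c"
        unfolding that by simp
      finally show ?thesis .
    qed
    from cancel[OF coeff] False show ?thesis
      unfolding log by (simp only: if_False)
  qed
qed

theorem theorem5p2:
  fixes M :: "'a measure" and Y :: "'a \<Rightarrow> real" and lam :: real and k :: nat
  assumes "prob_space M"
    and "distributed M lborel Y (\<lambda>x. indicator {0..1} x / measure lborel {0..1::real})"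
    and "lam \<noteq> 0"
    and "k \<ge> 1"
  shows "fps_const (1 / fact k) * prob_deg_log M Y lam ^ k =
           Abs_fps (\<lambda>n. if n < k then 0 else prob_deg_stirling1 M Y lam n k / fact n)
       \<and> Abs_fps (\<lambda>n. if n < k then 0 else prob_deg_stirling1 M Y lam n k / fact n) =
           Abs_fps (\<lambda>n. if n < k then 0 else
             2 ^ n / real n * real (n choose k) *
             (\<Sum>m = 0..n - k. real (n - m) * real ((n - k) choose m) *
                (\<Sum>js \<in> natpermute m n. multinomial m js * (\<Prod>j\<leftarrow>js. A2 j)) *
                (\<Sum>ls \<in> natpermute (n - k - m) k. multinomial (n - k - m) ls *
                   (lam ^ (n - k - m) / (\<Prod>l\<leftarrow>ls. real (l + 1))))) / fact n)"
proof -
  have stirling: "prob_deg_stirling1 M Y lam n k / fact n =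
      (fps_const (1 / fact k) * prob_deg_log M Y lam ^ k) $ n" for n
    unfolding prob_deg_stirling1_def by simp
  show ?thesis
    unfolding fps_eq_iff fps_nth_Abs_fps stirling prob_deg_log_power_nth[OF assms(2-4)] by simp
qed

end
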